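(* Let $\mathcal{GD}$ be a GDIFS with vertices $v_1,\dots,v_N$, contractions $(f_e)_{e\in E^1}$ with contraction ratios $\rho_e$, and condensation sets $C_1,\dots,C_N$. Let $O_1,\dots,O_N$ be its orbital sets and $s^*$ its Mauldin-Williams graph dimension. If $\overline{\dim}_B(C_i)=\overline{\dim}_B(C_j)$ for all $1\le i,j\le N$, then $$\overline{\dim}_B(O_i)\le \max\{s^*,\overline{\dim}_B(C_i)\}\quad\text{for all } 1\le i\le N.$$
   Context: Graph. $V=\{v_1,\dots,v_N\}$ is the vertex set of a finite directed graph (parallel edges and loops allowed) that is strongly connected: any vertex can be joined to any vertex by a directed path. $E^1$ is the set of edges, $E^*$ the set of finite directed paths $e=e_1\cdots e_k$ ($k\ge 1$, $e_l\in E^1$, $t(e_l)=i(e_{l+1})$); $i(e)=i(e_1)$ and $t(e)=t(e_k)$ are the initial and terminal vertices. $E_i^*$ (resp. $E_i^1$) is the set of paths (resp. edges) with initial vertex $v_i$; $E_{ij}^1$ is the set of edges from $v_i$ to $v_j$. A quantity indexed by a vertex $v_j$ may be indexed by $j$. GDIFS. To each vertex $v_j$ is attached a complete metric space $(X_{v_j},d_{v_j})$, a copy of $\mathbb{R}^n$ with the Euclidean metric, and to each edge $e\in E^1$ a contraction $f_e:X_{t(e)}\to X_{i(e)}$ with contraction ratio $\rho_e\in[0,1)$. For a path $e=e_1\cdots e_k$, $f_e=f_{e_1}\circ\cdots\circ f_{e_k}$. Condensation sets $C_j\subset X_{v_j}$, $1\le j\le N$, are fixed non-empty compact sets. Orbital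 sets: $O_i=C_i\cup\bigcup_{e\in E_i^*}f_e(C_{t(e)})$. Mauldin-Williams graph dimension: for $s\ge0$ let $\mathcal M(s)$ be the $N\times N$ matrix with entries $\mathcal M_{v_iv_j}(s)=\sum_{e\in E_{ij}^1}\rho_e^s$ and $\Phi(s)$ its spectral radius. $\Phi$ is taken to be continuous and strictly decreasing with $\Phi(0)\ge1$ and $\Phi(s)\to0$ as $s\to\infty$; $s^*$ is the unique positive real number with $\Phi(s^* )=1$. Upper box dimension of a non-empty bounded set $S$: $\overline{\dim}_B(S)=\limsup_{\delta\to0^+}\frac{\log N_\delta(S)}{-\log\delta}$, where $N_\delta(S)$ is the minimum number of sets of diameter (at most) $\delta$ needed to cover $S$. *)

theory Defs
  imports
    "HOL-Analysis.Analysis"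
    "Graph_Theory.Arc_Walk"
    "Jordan_Normal_Form.Spectral_Radius"
begin

section \<open>Upper box dimension\<close>

text \<open>
  The requirement \<^term>\<open>bounded A\<close> matters: for unbounded sets the real-valued
  \<^const>\<open>diameter\<close> is a meaningless supremum. For a totally bounded \<open>S\<close> and
  \<open>\<delta> > 0\<close> a finite cover exists, so that \<open>LEAST\<close> is the genuine minimum.
\<close>

definition covering_number :: "real \<Rightarrow> 'a::metric_space set \<Rightarrow> nat" where
  "covering_number \<delta> S =
     (LEAST k. \<exists>\<U>. finite \<U> \<and> card \<U> = k \<and> S \<subseteq> \<Union>\<U> \<and>
                 (\<forall>A\<in>\<U>. bounded A \<and> diameter A \<le> \<delta>))"

definition upper_box_dim :: "'a::metric_space set \<Rightarrow> ereal" where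
  "upper_box_dim S =
     Limsup (at_right 0) (\<lambda>\<delta>. ereal (ln (real (covering_number \<delta> S)) / - ln \<delta>))"


section \<open>Paths and the Mauldin-Williams matrix\<close>

text \<open>
  Directed multigraphs are \<^typ>\<open>('v, 'e) pre_digraph\<close>; a path is its non-empty list of edges.
  The initial vertex \<open>i(e)\<close> of an edge is \<^term>\<open>tail G e\<close>, the terminal vertex
  \<open>t(e)\<close> is \<^term>\<open>head G e\<close>.
\<close>

definition paths_from :: "('v, 'e) pre_digraph \<Rightarrow> 'v \<Rightarrow> 'e list set" where
  "paths_from G i = {p. p \<noteq> [] \<and> (\<exists>j. pre_digraph.awalk G i p j)}"

definition path_end :: "('v, 'e) pre_digraph \<Rightarrow> 'e list \<Rightarrow> 'v" where
  "path_end G p = head G (last p)"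

definition edges_between :: "('v, 'e) pre_digraph \<Rightarrow> 'v \<Rightarrow> 'v \<Rightarrow> 'e set" where
  "edges_between G i j = {e \<in> arcs G. tail G e = i \<and> head G e = j}"

text \<open>
  Vertices are the numbers \<open>0, \<dots>, N - 1\<close>. Note \<^term>\<open>0 powr s = (0::real)\<close> for all \<open>s\<close>,
  including \<open>s = 0\<close>: an edge of ratio \<open>0\<close> contributes nothing to the matrix, also at \<open>s = 0\<close>,
  which keeps the entries continuous on \<open>[0, \<infinity>)\<close>. For positive ratios no convention is involved.
\<close>

definition mw_matrix ::
    "(nat, 'e) pre_digraph \<Rightarrow> nat \<Rightarrow> ('e \<Rightarrow> real) \<Rightarrow> real \<Rightarrow> real Matrix.mat" where
  "mw_matrix G N \<rho> s = Matrix.mat N N (\<lambda>(i, j). \<Sum>e\<in>edges_between G i j. \<rho> e powr s)"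

definition mw_radius ::
    "(nat, 'e) pre_digraph \<Rightarrow> nat \<Rightarrow> ('e \<Rightarrow> real) \<Rightarrow> real \<Rightarrow> real" where
  "mw_radius G N \<rho> s = spectral_radius (map_mat complex_of_real (mw_matrix G N \<rho> s))"

definition mw_dimension :: "(nat, 'e) pre_digraph \<Rightarrow> nat \<Rightarrow> ('e \<Rightarrow> real) \<Rightarrow> real" where
  "mw_dimension G N \<rho> = (THE s. 0 < s \<and> mw_radius G N \<rho> s = 1)"


section \<open>Graph-directed systems with condensation\<close>

text \<open>
  All spaces \<open>X\<^sub>v\<close> are copies of \<open>\<real>\<^sup>n\<close>, hence represented by the single type
  \<^typ>\<open>real ^ 'n\<close>. A contraction ratio of \<open>f e\<close> is any Lipschitz constant \<open>\<rho> e < 1\<close>, not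
  necessarily the least one (non-negativity is part of \<^const>\<open>lipschitz_on\<close>).
\<close>

locale gdifs = fin_digraph G
  for G :: "(nat, 'e) pre_digraph" +
  fixes N :: nat
    and f :: "'e \<Rightarrow> real ^ 'n \<Rightarrow> real ^ 'n"
    and \<rho> :: "'e \<Rightarrow> real"
    and C :: "nat \<Rightarrow> (real ^ 'n) set"
  assumes N_pos: "N \<ge> 1"
    and verts_eq: "verts G = {..<N}"
    and strongly_conn:
      "\<And>i j. i \<in> verts G \<Longrightarrow> j \<in> verts G \<Longrightarrow> \<exists>p\<in>paths_from G i. path_end G p = j"
    and contraction: "\<And>e. e \<in> arcs G \<Longrightarrow> (\<rho> e)-lipschitz_on UNIV (f e)"
    and ratio_less_1: "\<And>e. e \<in> arcs G \<Longrightarrow> \<rho> e < 1"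
    and C_compact: "\<And>i. i \<in> verts G \<Longrightarrow> compact (C i)"
    and C_nonempty: "\<And>i. i \<in> verts G \<Longrightarrow> C i \<noteq> {}"
    and radius_continuous: "continuous_on {0..} (mw_radius G N \<rho>)"
    and radius_decreasing: "strict_antimono_on {0..} (mw_radius G N \<rho>)"
    and radius_0: "mw_radius G N \<rho> 0 \<ge> 1"
    and radius_tendsto_0: "(mw_radius G N \<rho> \<longlongrightarrow> 0) at_top"
    and mw_dimension_exists: "\<exists>!s. 0 < s \<and> mw_radius G N \<rho> s = 1"

text \<open>\<^term>\<open>foldr f [e\<^sub>1, e\<^sub>2, e\<^sub>3] = f e\<^sub>1 \<circ> f e\<^sub>2 \<circ> f e\<^sub>3\<close>, i.e. \<^term>\<open>foldr f p\<close> is the map \<open>f\<^sub>p\<close> of a path \<open>p\<close>.\<close>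

definition orbital_set ::
    "(nat, 'e) pre_digraph \<Rightarrow> ('e \<Rightarrow> 'a \<Rightarrow> 'a) \<Rightarrow> (nat \<Rightarrow> 'a set) \<Rightarrow> nat \<Rightarrow> 'a set" where
  "orbital_set G f C i = C i \<union> (\<Union>p\<in>paths_from G i. foldr f p ` C (path_end G p))"

end

theory Submission
  imports Defs
begin

text \<open>
  Fix \<open>t\<close> above both \<open>s\<^sup>*\<close> and the dimension of the condensation sets. The orbital sets satisfy
  \<open>O\<^sub>i = C\<^sub>i \<union> \<Union>\<^sub>e f\<^sub>e(O\<^bsub>t(e)\<^esub>)\<close>, whence
  \<open>N\<^sub>\<delta>(O\<^sub>i) \<le> N\<^sub>\<delta>(C\<^sub>i) + \<Sum>\<^sub>e N\<^bsub>\<delta>/\<rho>(e)\<^esub>(O\<^bsub>t(e)\<^esub>)\<close>. As the spectral radius of \<open>M(t')\<close> is less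
  than one for \<open>s\<^sup>* < t' < t\<close>, the powers of \<open>M(t')\<close> are bounded, and a truncated Neumann series
  gives \<open>h \<ge> 0\<close> with \<open>M(t) h \<le> h - 1/2\<close>. Induction on the scale, in steps of the largest ratio,
  then yields \<open>N\<^sub>\<delta>(O\<^sub>i) \<le> M + K h\<^sub>i \<delta>\<^sup>-\<^sup>t\<close>.
\<close>

section \<open>Covering numbers\<close>

lemma covering_number_le:
  assumes "finite \<U>" "S \<subseteq> \<Union>\<U>" "\<And>A. A \<in> \<U> \<Longrightarrow> bounded A \<and> diameter A \<le> \<delta>"
  shows "covering_number \<delta> S \<le> card \<U>"
  unfolding covering_number_def by (rule Least_le) (use assms in blast)

text \<open>Total boundedness of the compact closure yields one finite cover by balls of radius
  \<open>\<delta>/2\<close>, so the \<open>LEAST\<close> is attained and optimal covers can be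
  manipulated.\<close>

lemma covering_number_cover:
  fixes S :: "'a::euclidean_space set"
  assumes "bounded S" "\<delta> > 0"
  obtains \<U> where "finite \<U>" "card \<U> = covering_number \<delta> S" "S \<subseteq> \<Union>\<U>"
    "\<And>A. A \<in> \<U> \<Longrightarrow> bounded A \<and> diameter A \<le> \<delta>"
proof -
  have "compact (closure S)"
    using assms by simp
  then obtain k where k: "finite k" "closure S \<subseteq> (\<Union>x\<in>k. ball x (\<delta>/2))"
    using seq_compact_imp_totally_bounded[of "closure S"] assms
    by (metis compact_eq_seq_compact_metric half_gt_zero)
  let ?\<U> = "(\<lambda>x. ball x (\<delta>/2)) ` k"
  have "finite ?\<U> \<and> card ?\<U> = card ?\<U> \<and> S \<subseteq> \<Union>?\<U> \<and> (\<forall>A\<in>?\<U>. bounded A \<and> diameter A \<le> \<delta>)"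
    using k closure_subset[of S] assms by auto
  then have "\<exists>\<U>. finite \<U> \<and> card \<U> = covering_number \<delta> S \<and> S \<subseteq> \<Union>\<U> \<and>
      (\<forall>A\<in>\<U>. bounded A \<and> diameter A \<le> \<delta>)"
    unfolding covering_number_def
    by (intro LeastI[where P = "\<lambda>k. \<exists>\<U>. finite \<U> \<and> card \<U> = k \<and> S \<subseteq> \<Union>\<U> \<and>
      (\<forall>A\<in>\<U>. bounded A \<and> diameter A \<le> \<delta>)"]) blast
  then show thesis
    using that by blast
qed

lemma covering_number_mono:
  fixes S T :: "'a::euclidean_space set"
  assumes "S \<subseteq> T" "bounded T" "0 < \<epsilon>" "\<epsilon> \<le> \<delta>"
  shows "covering_number \<delta> S \<le> covering_number \<epsilon> T"
proof -
  obtain \<U> where \<U>: "finite \<U>" "card \<U> = covering_number \<epsilon> T" "T \<subseteq> \<Union>\<U>"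
    "\<And>A. A \<in> \<U> \<Longrightarrow> bounded A \<and> diameter A \<le> \<epsilon>"
    using covering_number_cover[of T \<epsilon>] assms by blast
  then show ?thesis
    using covering_number_le[of \<U> S \<delta>] assms by (metis order_trans)
qed

lemma covering_number_Un:
  fixes S T :: "'a::euclidean_space set"
  assumes "bounded S" "bounded T" "0 < \<delta>"
  shows "covering_number \<delta> (S \<union> T) \<le> covering_number \<delta> S + covering_number \<delta> T"
proof -
  obtain \<U> where \<U>: "finite \<U>" "card \<U> = covering_number \<delta> S" "S \<subseteq> \<Union>\<U>"
    "\<And>A. A \<in> \<U> \<Longrightarrow> bounded A \<and> diameter A \<le> \<delta>"
    using covering_number_cover[of S \<delta>] assms by blast
  obtain \<V> where \<V>: "finite \<V>" "card \<V> = covering_number \<delta> T" "T \<subseteq> \<Union>\<V>"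
    "\<And>A. A \<in> \<V> \<Longrightarrow> bounded A \<and> diameter A \<le> \<delta>"
    using covering_number_cover[of T \<delta>] assms by blast
  have "covering_number \<delta> (S \<union> T) \<le> card (\<U> \<union> \<V>)"
    using \<U> \<V> by (intro covering_number_le) auto
  also have "\<dots> \<le> card \<U> + card \<V>"
    by (rule card_Un_le)
  finally show ?thesis
    using \<U> \<V> by simp
qed

lemma covering_number_UN:
  fixes F :: "'i \<Rightarrow> 'a::euclidean_space set"
  assumes "finite I" "\<And>i. i \<in> I \<Longrightarrow> bounded (F i)" "0 < \<delta>"
  shows "covering_number \<delta> (\<Union>i\<in>I. F i) \<le> (\<Sum>i\<in>I. covering_number \<delta> (F i))"
  using assms
proof (induction I)
  case empty
  show ?case
    using covering_number_le[of "{}" "{}" \<delta>] by simp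
next
  case (insert i I)
  have "covering_number \<delta> (F i \<union> (\<Union>i\<in>I. F i))
      \<le> covering_number \<delta> (F i) + covering_number \<delta> (\<Union>i\<in>I. F i)"
    using insert by (intro covering_number_Un bounded_UN) auto
  then show ?case
    using insert by force
qed

text \<open>Images of an optimal cover at scale \<open>\<eta>\<close> have diameter at most
  \<open>L * \<eta>\<close>. A free \<open>\<eta>\<close> in place of \<open>\<delta> / L\<close>
  includes \<open>L = 0\<close>, where any positive \<open>\<eta>\<close> is admissible.\<close>

lemma covering_number_lipschitz_image:
  fixes S :: "'a::euclidean_space set" and g :: "'a \<Rightarrow> 'b::euclidean_space"
  assumes "L-lipschitz_on UNIV g" "bounded S" "0 < \<eta>" "L * \<eta> \<le> \<delta>"
  shows "covering_number \<delta> (g ` S) \<le> covering_number \<eta> S"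
proof -
  have L: "0 \<le> L"
    using assms lipschitz_on_nonneg by blast
  obtain \<U> where \<U>: "finite \<U>" "card \<U> = covering_number \<eta> S" "S \<subseteq> \<Union>\<U>"
    "\<And>A. A \<in> \<U> \<Longrightarrow> bounded A \<and> diameter A \<le> \<eta>"
    using covering_number_cover[of S \<eta>] assms by blast
  have "bounded (g ` A) \<and> diameter (g ` A) \<le> \<delta>" if "A \<in> \<U>" for A
  proof
    show "bounded (g ` A)"
      using \<U>(4)[OF that] assms(1)
      by (meson bounded_uniformly_continuous_image lipschitz_on_subset
          lipschitz_on_uniformly_continuous subset_UNIV)
    have "norm (g x - g y) \<le> \<delta>" if xy: "x \<in> A" "y \<in> A" for x y
    proof -
      have "norm (g x - g y) \<le> L * dist x y"
        using lipschitz_onD[OF assms(1), of x y] by (simp add: dist_norm)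
      also have "dist x y \<le> \<eta>"
        using diameter_bounded_bound[of A x y] \<U>(4)[OF \<open>A \<in> \<U>\<close>] xy by linarith
      finally show ?thesis
        using assms(4) L by (smt (verit) mult_left_mono)
    qed
    moreover have "0 \<le> \<delta>"
      using L assms by (smt (verit) mult_nonneg_nonneg)
    ultimately show "diameter (g ` A) \<le> \<delta>"
      by (intro diameter_le) auto
  qed
  then have "covering_number \<delta> (g ` S) \<le> card ((`) g ` \<U>)"
    using \<U>(1,3) by (intro covering_number_le) (auto, blast)
  also have "\<dots> \<le> card \<U>"
    using \<U> by (intro card_image_le)
  finally show ?thesis
    using \<U> by simp
qed

section \<open>Upper box dimension and power bounds on covering numbers\<close>

text \<open>The limsup controls only small scales. On the remaining scales up to 1 the covering
  number is at most its value at a fixed \<open>\<epsilon>\<close>, which the constant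
  \<open>K\<close> absorbs.\<close>

lemma covering_number_powr_bound_if_dim_less:
  fixes S :: "'a::euclidean_space set"
  assumes "bounded S" "upper_box_dim S < ereal t" "0 \<le> t"
  obtains K where "0 \<le> K" "\<And>\<delta>. 0 < \<delta> \<Longrightarrow> \<delta> \<le> 1 \<Longrightarrow> real (covering_number \<delta> S) \<le> K * \<delta> powr -t"
proof -
  have "\<forall>\<^sub>F \<delta> in at_right 0. ereal (ln (real (covering_number \<delta> S)) / - ln \<delta>) < ereal t"
    using assms(2) unfolding upper_box_dim_def by (rule Limsup_lessD)
  then obtain b where b: "b > 0"
    "\<And>\<delta>. 0 < \<delta> \<Longrightarrow> \<delta> < b \<Longrightarrow> ln (real (covering_number \<delta> S)) / - ln \<delta> < t"
    by (auto simp: eventually_at_right_field)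
  \<comment> \<open>Below \<open>\<epsilon>\<close> the limsup estimate holds and
    \<open>- ln \<delta>\<close> is positive, so the quotient can be cleared.\<close>
  define \<epsilon> where "\<epsilon> = min (b/2) (1/2)"
  have \<epsilon>: "0 < \<epsilon>" "\<epsilon> < b" "\<epsilon> < 1"
    using b by (auto simp: \<epsilon>_def min_def)
  define K where "K = max 1 (real (covering_number \<epsilon> S))"
  show thesis
  proof (rule that[of K])
    show "0 \<le> K" by (simp add: K_def)
    fix \<delta> :: real assume \<delta>: "0 < \<delta>" "\<delta> \<le> 1"
    have ge1: "1 \<le> \<delta> powr -t"
      using \<delta> assms by (simp add: ge_one_powr_ge_zero powr_minus one_le_inverse powr_le1)
    show "real (covering_number \<delta> S) \<le> K * \<delta> powr -t"
    proof (cases "\<delta> < \<epsilon>")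
      case True
      have neg: "- ln \<delta> > 0"
        using \<delta> True \<epsilon> by (simp add: ln_less_zero)
      have "real (covering_number \<delta> S) \<le> \<delta> powr -t"
      \<comment> \<open>Removing the logarithm requires a positive count, hence the separate zero
        case.\<close>
      proof (cases "covering_number \<delta> S = 0")
        case False
        have "ln (real (covering_number \<delta> S)) < t * - ln \<delta>"
          using b(2)[of \<delta>] \<delta> True \<epsilon> pos_divide_less_eq[OF neg] by simp
        also have "\<dots> = ln (\<delta> powr -t)"
          using \<delta> by (simp add: ln_powr)
        finally show ?thesis
          using False \<delta> by (subst (asm) ln_less_cancel_iff) auto
      qed simp
      also have "\<dots> \<le> K * \<delta> powr -t"
        by (simp add: K_def mult_le_cancel_right1)
      finally show ?thesis .
    next
      case False
      then have "covering_number \<delta> S \<le> covering_number \<epsilon> S"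
        using assms \<epsilon> by (intro covering_number_mono) auto
      also have "real \<dots> \<le> K * 1"
        by (simp add: K_def)
      also have "\<dots> \<le> K * \<delta> powr -t"
        using ge1 by (intro mult_left_mono) (auto simp: K_def)
      finally show ?thesis by simp
    qed
  qed
qed

text \<open>After taking logarithms and dividing by \<open>- ln \<delta>\<close>, the multiplicative
  constant contributes a term that tends to 0.\<close>

lemma upper_box_dim_le_if_covering_number_powr_bound:
  assumes bound: "\<And>\<delta>. 0 < \<delta> \<Longrightarrow> \<delta> \<le> 1 \<Longrightarrow> real (covering_number \<delta> S) \<le> K * \<delta> powr -t"
    and "0 \<le> t"
  shows "upper_box_dim S \<le> ereal t"
proof -
  \<comment> \<open>Enlarging the constant to at least 1 makes
    \<open>ln (K' * \<delta> powr -t)\<close> nonnegative; this covers a zero count, where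
    \<open>ln 0 = 0\<close>.\<close>
  define K' where "K' = max 1 K"
  have "((\<lambda>\<delta>. ln K' / - ln \<delta> + t) \<longlongrightarrow> 0 + t) (at_right (0::real))"
  proof (intro tendsto_add tendsto_const)
    have "filterlim (\<lambda>\<delta>. - ln \<delta>) at_top (at_right (0::real))"
      using ln_at_0 by (simp add: filterlim_uminus_at_bot)
    then show "((\<lambda>\<delta>. ln K' / - ln \<delta>) \<longlongrightarrow> 0) (at_right (0::real))"
      by (intro tendsto_divide_0[OF tendsto_const] filterlim_at_top_imp_at_infinity)
  qed
  then have lim: "((\<lambda>\<delta>. ereal (ln K' / - ln \<delta> + t)) \<longlongrightarrow> ereal t) (at_right (0::real))"
    by simp
  have "\<forall>\<^sub>F \<delta> in at_right (0::real). 0 < \<delta> \<and> \<delta> < 1"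
    by (auto simp: eventually_at_right_field intro: exI[of _ 1])
  then have "\<forall>\<^sub>F \<delta> in at_right 0.
      ereal (ln (real (covering_number \<delta> S)) / - ln \<delta>) \<le> ereal (ln K' / - ln \<delta> + t)"
  proof eventually_elim
    case (elim \<delta>)
    then have neg: "- ln \<delta> > 0"
      by (simp add: ln_less_zero)
    have ge1: "1 \<le> \<delta> powr -t"
      using elim \<open>0 \<le> t\<close> by (simp add: powr_minus one_le_inverse powr_le1)
    have "ln (real (covering_number \<delta> S)) \<le> ln (K' * \<delta> powr -t)"
    proof (cases "covering_number \<delta> S = 0")
      case True
      have "1 * 1 \<le> K' * \<delta> powr -t"
        using ge1 by (intro mult_mono) (auto simp: K'_def)
      then show ?thesis
        using True by simp
    next
      case False
      have "real (covering_number \<delta> S) \<le> K' * \<delta> powr -t"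
        using bound[of \<delta>] elim by (smt (verit) K'_def mult_right_mono powr_ge_zero)
      then show ?thesis
        using False by (subst ln_le_cancel_iff) auto
    qed
    also have "\<dots> = ln K' + t * - ln \<delta>"
      using elim by (simp add: K'_def ln_mult ln_powr)
    finally have "ln (real (covering_number \<delta> S)) / - ln \<delta> \<le> (ln K' + t * - ln \<delta>) / - ln \<delta>"
      using neg by (intro divide_right_mono) auto
    also have "\<dots> = ln K' / - ln \<delta> + t"
      using neg by (simp add: field_simps)
    finally show ?case
      by simp
  qed
  then have "upper_box_dim S \<le> Limsup (at_right 0) (\<lambda>\<delta>. ereal (ln K' / - ln \<delta> + t))"
    unfolding upper_box_dim_def by (rule Limsup_mono)
  also have "\<dots> = ereal t"
    using lim by (intro lim_imp_Limsup) auto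
  finally show ?thesis .
qed


section \<open>A strict supersolution for the Mauldin-Williams matrix\<close>

text \<open>The Jordan normal form bounds all entries of all powers by one constant. Boundedness
  suffices for the series below, whose decay comes from a separate factor
  \<open>\<theta>\<close>.\<close>

lemma bounded_power_row_sums:
  fixes B :: "real Matrix.mat"
  assumes B: "B \<in> carrier_mat n n" and "spectral_radius (map_mat complex_of_real B) < 1"
  obtains c where "\<And>k i. i < n \<Longrightarrow> (\<Sum>j<n. (B ^\<^sub>m k) $$ (i, j)) \<le> c"
proof -
  obtain c where c: "norm_bound (map_mat complex_of_real B ^\<^sub>m k) c" for k
    using spectral_radius_jnf_norm_bound_less_1_upper_triangular[of "map_mat complex_of_real B" n]
      assms by auto
  have "(\<Sum>j<n. (B ^\<^sub>m k) $$ (i, j)) \<le> real n * c" if i: "i < n" for i k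
  proof -
    have "(B ^\<^sub>m k) $$ (i, j) \<le> c" if "j < n" for j
    proof -
      have "norm ((map_mat complex_of_real (B ^\<^sub>m k)) $$ (i, j)) \<le> c"
        using c[of k] i that B
        by (simp add: norm_bound_def flip: of_real_hom.mat_hom_pow[OF B])
      moreover have "dim_row (B ^\<^sub>m k) = n" "dim_col (B ^\<^sub>m k) = n"
        using pow_carrier_mat[OF B, of k] by auto
      ultimately have "\<bar>(B ^\<^sub>m k) $$ (i, j)\<bar> \<le> c"
        using i that by (simp del: pow_mat_dim pow_mat_dim_square)
      then show ?thesis
        by simp
    qed
    then show ?thesis
      using sum_bounded_above[of "{..<n}" "\<lambda>j. (B ^\<^sub>m k) $$ (i, j)" c] by simp
  qed
  then show thesis
    using that by blast
qed

lemma sum_power_mat_Suc: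
  fixes B :: "'a::comm_semiring_1 Matrix.mat"
  assumes B: "B \<in> carrier_mat n n" and "i < n"
  shows "(\<Sum>j<n. (B ^\<^sub>m Suc k) $$ (i, j)) = (\<Sum>l<n. B $$ (i, l) * (\<Sum>j<n. (B ^\<^sub>m k) $$ (l, j)))"
proof -
  have Bk: "B ^\<^sub>m m \<in> carrier_mat n n" for m
    using B by simp
  \<comment> \<open>\<open>^\<^sub>m\<close> appends the new factor on the right, while splitting
    off the first edge of a path needs it on the left.\<close>
  have "B ^\<^sub>m Suc k = B * B ^\<^sub>m k"
  proof (induction k)
    case (Suc k)
    then show ?case
      using B Bk[of k] by (simp add: assoc_mult_mat[of _ n n _ n _ n])
  qed (use B in simp)
  then have "(\<Sum>j<n. (B ^\<^sub>m Suc k) $$ (i, j)) = (\<Sum>j<n. \<Sum>l<n. B $$ (i, l) * (B ^\<^sub>m k) $$ (l, j))"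
    using B Bk[of k] \<open>i < n\<close> by (auto simp: scalar_prod_def atLeast0LessThan intro!: sum.cong)
  also have "\<dots> = (\<Sum>l<n. B $$ (i, l) * (\<Sum>j<n. (B ^\<^sub>m k) $$ (l, j)))"
    by (subst sum.swap) (simp add: sum_distrib_left)
  finally show ?thesis .
qed

context gdifs
begin

lemma head_less_N: "e \<in> arcs G \<Longrightarrow> head G e < N"
  using head_in_verts verts_eq by auto

lemma ratio_nonneg: "e \<in> arcs G \<Longrightarrow> 0 \<le> \<rho> e"
  using contraction lipschitz_on_nonneg by blast

lemma uniform_ratio:
  obtains q where "0 < q" "q < 1" "\<And>e. e \<in> arcs G \<Longrightarrow> \<rho> e \<le> q"
\<comment> \<open>The extra \<open>1/2\<close> keeps \<open>q\<close> positive even if all ratios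
  vanish, so that every \<open>q ^ n\<close> is a legitimate scale.\<close>
proof (rule that[of "Max (insert (1/2) (\<rho> ` arcs G))"])
  have fin: "finite (insert (1/2) (\<rho> ` arcs G))"
    by simp
  show "Max (insert (1/2) (\<rho> ` arcs G)) < 1"
    using ratio_less_1 fin by (subst Max_less_iff) auto
  have "1/2 \<le> Max (insert (1/2) (\<rho> ` arcs G))"
    using fin by (intro Max_ge) auto
  then show "0 < Max (insert (1/2) (\<rho> ` arcs G))"
    by linarith
  show "\<And>e. e \<in> arcs G \<Longrightarrow> \<rho> e \<le> Max (insert (1/2) (\<rho> ` arcs G))"
    using fin by (intro Max_ge) auto
qed

text \<open>Grouping edges by their head links the edge sums that arise from covers with the
  matrix-vector product governed by the spectral radius.\<close>

lemma sum_out_arcs: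
  fixes h :: "nat \<Rightarrow> real"
  assumes "i < N"
  shows "(\<Sum>e\<in>out_arcs G i. \<rho> e powr s * h (head G e))
    = (\<Sum>j<N. mw_matrix G N \<rho> s $$ (i, j) * h j)"
proof -
  have "(\<Sum>e\<in>out_arcs G i. \<rho> e powr s * h (head G e))
      = (\<Sum>j<N. \<Sum>e\<in>{e \<in> out_arcs G i. head G e = j}. \<rho> e powr s * h (head G e))"
    using head_less_N by (intro sum.group[symmetric]) (auto simp: out_arcs_def)
  also have "\<dots> = (\<Sum>j<N. mw_matrix G N \<rho> s $$ (i, j) * h j)"
    using assms
    by (auto simp: mw_matrix_def edges_between_def sum_distrib_right out_arcs_def intro!: sum.cong)
  finally show ?thesis .
qed

text \<open>Raising the exponent from \<open>s\<close> to \<open>t\<close> gains a factor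
  \<open>\<theta> < 1\<close> on every edge. For \<open>h\<close> the sum of
  \<open>\<theta> ^ k\<close> times \<open>B ^\<^sub>m k\<close> applied to the all-ones vector,
  over \<open>k < m\<close>, applying \<open>\<theta> * B\<close> shifts the series: the initial 1
  is lost and a remainder below \<open>1/2\<close> is gained.\<close>

lemma supersolution:
  assumes s: "mw_radius G N \<rho> s < 1" and "s < t"
  obtains h :: "nat \<Rightarrow> real" where "\<And>i. 0 \<le> h i"
    "\<And>i. i < N \<Longrightarrow> (\<Sum>e\<in>out_arcs G i. \<rho> e powr t * h (head G e)) \<le> h i - 1/2"
proof -
  obtain q where q: "0 < q" "q < 1" "\<And>e. e \<in> arcs G \<Longrightarrow> \<rho> e \<le> q"
    using uniform_ratio by blast
  define \<theta> where "\<theta> = q powr (t - s)"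
  have \<theta>: "0 < \<theta>" "\<theta> < 1"
    using q \<open>s < t\<close> by (auto simp: \<theta>_def powr_less_mono2[of "t - s" q 1, simplified])
  define B where "B = mw_matrix G N \<rho> s"
  have B: "B \<in> carrier_mat N N"
    by (simp add: B_def mw_matrix_def)
  \<comment> \<open>\<open>b k i\<close> is the total weight of the walks of length \<open>k\<close>
    from \<open>i\<close>, each weighted by the product of its
    \<open>\<rho> e powr s\<close>.\<close>
  define b where "b k i = (\<Sum>j<N. (B ^\<^sub>m k) $$ (i, j))" for k i
  obtain c where c: "\<And>k i. i < N \<Longrightarrow> b k i \<le> c"
    using bounded_power_row_sums[OF B] s by (metis B_def b_def mw_radius_def)
  have b_0: "b 0 i = 1" if "i < N" for i
    using that B by (simp add: b_def)
  have b_Suc: "b (Suc k) i = (\<Sum>e\<in>out_arcs G i. \<rho> e powr s * b k (head G e))" if "i < N" for k i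
    using sum_power_mat_Suc[OF B that, of k] sum_out_arcs[OF that, of s "b k"]
    unfolding b_def B_def by simp
  have b_nonneg: "0 \<le> b k i" if "i < N" for k i
    using that
  proof (induction k arbitrary: i)
    case (Suc k)
    then show ?case
      using head_less_N by (auto simp: b_Suc intro!: sum_nonneg)
  qed (simp add: b_0)
  have "(\<lambda>m. \<theta> ^ m * c) \<longlonglongrightarrow> 0 * c"
    using \<theta> by (intro tendsto_mult tendsto_const LIMSEQ_realpow_zero) auto
  then have "\<forall>\<^sub>F m in sequentially. \<theta> ^ m * c < 1/2"
    by (intro order_tendstoD(2)) auto
  then obtain m where m: "\<theta> ^ m * c < 1/2"
    using eventually_sequentially by auto
  \<comment> \<open>The value 0 outside the vertex range makes \<open>h\<close> nonnegative
    everywhere.\<close>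
  define h where "h i = (if i < N then \<Sum>k<m. \<theta> ^ k * b k i else 0)" for i
  have "(\<Sum>e\<in>out_arcs G i. \<rho> e powr t * h (head G e)) \<le> h i - 1/2" if i: "i < N" for i
  proof -
    have h_nonneg: "0 \<le> h j" for j
      using b_nonneg \<theta> by (auto simp: h_def intro!: sum_nonneg)
    \<comment> \<open>Edges of ratio 0 are included, since \<open>0 powr x = 0\<close> makes both
      sides vanish.\<close>
    have "\<rho> e powr t \<le> \<theta> * \<rho> e powr s" if "e \<in> arcs G" for e
    proof -
      have "\<rho> e powr t = \<rho> e powr (t - s) * \<rho> e powr s"
        by (simp flip: powr_add)
      also have "\<dots> \<le> \<theta> * \<rho> e powr s"
        unfolding \<theta>_def using q(3) that ratio_nonneg \<open>s < t\<close>
        by (intro mult_right_mono powr_mono2) auto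
      finally show ?thesis .
    qed
    then have "(\<Sum>e\<in>out_arcs G i. \<rho> e powr t * h (head G e))
        \<le> (\<Sum>e\<in>out_arcs G i. \<theta> * \<rho> e powr s * h (head G e))"
      using h_nonneg by (intro sum_mono mult_right_mono) (auto simp: out_arcs_def)
    also have "\<dots> = (\<Sum>e\<in>out_arcs G i. \<Sum>k<m. \<theta> ^ Suc k * (\<rho> e powr s * b k (head G e)))"
      using head_less_N
      by (intro sum.cong) (auto simp: h_def out_arcs_def sum_distrib_left mult_ac)
    also have "\<dots> = (\<Sum>k<m. \<theta> ^ Suc k * b (Suc k) i)"
      by (subst sum.swap) (simp add: sum_distrib_left b_Suc[OF i])
    \<comment> \<open>Index shift: the sum over \<open>1, ..., m\<close> differs from
      \<open>h i\<close> by its two end terms.\<close>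
    also have "\<dots> = h i - b 0 i + \<theta> ^ m * b m i"
      using sum.lessThan_Suc_shift[of "\<lambda>k. \<theta> ^ k * b k i" m] i by (simp add: h_def)
    also have "\<theta> ^ m * b m i \<le> \<theta> ^ m * c"
      using c[OF i] \<theta> by (intro mult_left_mono) auto
    finally show ?thesis
      using m b_0[OF i] by linarith
  qed
  moreover have "0 \<le> h i" for i
    using b_nonneg \<theta> by (auto simp: h_def intro!: sum_nonneg)
  ultimately show thesis
    using that by blast
qed


section \<open>Orbital sets\<close>

text \<open>If \<open>D\<close> bounds the condensation sets and all points \<open>f e 0\<close>,
  then \<open>f e\<close> sends norm at most \<open>R\<close> to norm at most
  \<open>D + q * R\<close>; the radius is the fixed point of this affine map.\<close>

lemma invariant_ball:
  obtains R where "\<And>i. i < N \<Longrightarrow> C i \<subseteq> cball 0 R" "\<And>e. e \<in> arcs G \<Longrightarrow> f e ` cball 0 R \<subseteq> cball 0 R"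
proof -
  obtain q where q: "0 < q" "q < 1" "\<And>e. e \<in> arcs G \<Longrightarrow> \<rho> e \<le> q"
    using uniform_ratio by blast
  have "bounded (\<Union>i<N. C i)"
    using C_compact verts_eq by (auto intro!: bounded_UN compact_imp_bounded)
  then have "bounded ((\<Union>i<N. C i) \<union> (\<lambda>e. f e 0) ` arcs G)"
    by (simp add: finite_imp_bounded)
  then obtain D where D: "D > 0" "\<And>x. x \<in> (\<Union>i<N. C i) \<union> (\<lambda>e. f e 0) ` arcs G \<Longrightarrow> norm x \<le> D"
    by (meson bounded_pos)
  define R where "R = D / (1 - q)"
  have R: "D + q * R = R" "D \<le> R" "0 \<le> R"
    using q D by (auto simp: R_def field_simps)
  show thesis
  proof (rule that[of R])
    show "C i \<subseteq> cball 0 R" if "i < N" for i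
      using D(2) R that by fastforce
    show "f e ` cball 0 R \<subseteq> cball 0 R" if e: "e \<in> arcs G" for e
    proof -
      have "norm (f e x) \<le> R" if "norm x \<le> R" for x
      proof -
        have "norm (f e x - f e 0) \<le> \<rho> e * norm x"
          using lipschitz_onD[OF contraction[OF e], of x 0] by (simp add: dist_norm)
        also have "\<dots> \<le> q * R"
          using q e that ratio_nonneg by (intro mult_mono) auto
        finally have "norm (f e x) \<le> norm (f e 0) + q * R"
          using norm_triangle_ineq2[of "f e x" "f e 0"] by linarith
        also have "norm (f e 0) \<le> D"
          using D e by auto
        finally show ?thesis
          using R by linarith
      qed
      then show ?thesis by auto
    qed
  qed
qed

lemma path_end_less_N:
  assumes "p \<in> paths_from G i"
  shows "path_end G p < N"
proof -
  have "last p \<in> arcs G"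
    using assms by (auto simp: paths_from_def awalk_def)
  then show ?thesis
    by (simp add: path_end_def head_less_N)
qed

text \<open>Induction along a path keeps every orbit in the invariant ball. Bounding the union lets
  a single unit-scale count serve all vertices.\<close>

lemma orbital_set_bounded: "bounded (\<Union>i<N. orbital_set G f C i)"
proof -
  obtain R where R: "\<And>i. i < N \<Longrightarrow> C i \<subseteq> cball 0 R"
      "\<And>e. e \<in> arcs G \<Longrightarrow> f e ` cball 0 R \<subseteq> cball 0 R"
    using invariant_ball by blast
  have "foldr f p x \<in> cball 0 R" if "set p \<subseteq> arcs G" "x \<in> cball 0 R" for p x
    using that
  proof (induction p)
    case (Cons e p)
    then show ?case
      using R(2)[of e] by (simp add: image_subset_iff del: mem_cball)
  qed simp
  moreover have "set p \<subseteq> arcs G" if "p \<in> paths_from G i" for p i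
    using that by (auto simp: paths_from_def awalk_def)
  ultimately have "foldr f p ` C (path_end G p) \<subseteq> cball 0 R" if "p \<in> paths_from G i" for p i
    using R(1)[OF path_end_less_N[OF that]] that by blast
  then have "(\<Union>i<N. orbital_set G f C i) \<subseteq> cball 0 R"
    using R(1) unfolding orbital_set_def by blast
  then show ?thesis
    using bounded_cball bounded_subset by blast
qed

text \<open>Split off the first edge \<open>e\<close> of a path: the rest is a path from the head of
  \<open>e\<close>, or empty, in which case the condensation set at that head appears.\<close>

lemma orbital_set_subset:
  "orbital_set G f C i \<subseteq> C i \<union> (\<Union>e\<in>out_arcs G i. f e ` orbital_set G f C (head G e))"
proof -
  have "foldr f p ` C (path_end G p) \<subseteq> (\<Union>e\<in>out_arcs G i. f e ` orbital_set G f C (head G e))"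
    if p: "p \<in> paths_from G i" for p
  proof -
    obtain e p' where [simp]: "p = e # p'"
      using p by (cases p) (auto simp: paths_from_def)
    have e: "e \<in> out_arcs G i" and walk: "\<exists>j. awalk (head G e) p' j"
      using p by (auto simp: paths_from_def awalk_Cons_iff)
    have "foldr f p' ` C (path_end G p) \<subseteq> orbital_set G f C (head G e)"
    proof (cases "p' = []")
      case False
      then have "p' \<in> paths_from G (head G e)" "path_end G p = path_end G p'"
        using walk by (auto simp: paths_from_def path_end_def)
      then show ?thesis
        by (auto simp: orbital_set_def)
    qed (auto simp: orbital_set_def path_end_def)
    then show ?thesis
      using e by fastforce
  qed
  then show ?thesis
    by (auto simp: orbital_set_def)
qed

section \<open>Induction on the scale for orbital sets\<close>

text \<open>Pulling back along \<open>e\<close> enlarges the scale by \<open>1 / \<rho> e\<close>,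
  at least \<open>1 / q\<close>, so a scale above \<open>q ^ Suc n\<close> moves above
  \<open>q ^ n\<close>. The summand \<open>M\<close> handles scales beyond 1, where
  \<open>\<delta> powr -t\<close> may be arbitrarily small; the slack \<open>1/2\<close> in
  \<open>super\<close> pays for the condensation sets and for one \<open>M\<close> per edge.\<close>

lemma covering_number_orbital_set_le:
  fixes h :: "nat \<Rightarrow> real"
  assumes "0 \<le> t" and h: "\<And>i. 0 \<le> h i"
    and super: "\<And>i. i < N \<Longrightarrow> (\<Sum>e\<in>out_arcs G i. \<rho> e powr t * h (head G e)) \<le> h i - 1/2"
    and K\<^sub>C: "0 \<le> K\<^sub>C"
      "\<And>i \<delta>. i < N \<Longrightarrow> 0 < \<delta> \<Longrightarrow> \<delta> \<le> 1 \<Longrightarrow> real (covering_number \<delta> (C i)) \<le> K\<^sub>C * \<delta> powr -t"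
  obtains M K where "0 \<le> M" "\<forall>i<N. \<forall>\<delta>>0.
    real (covering_number \<delta> (orbital_set G f C i)) \<le> M + K * h i * \<delta> powr -t"
proof -
  obtain q where q: "0 < q" "q < 1" "\<And>e. e \<in> arcs G \<Longrightarrow> \<rho> e \<le> q"
    using uniform_ratio by blast
  let ?O = "orbital_set G f C"
  define M where "M = real (covering_number 1 (\<Union>i<N. ?O i))"
  define m where "m = real (card (arcs G))"
  \<comment> \<open>Chosen so that the slack \<open>K / 2\<close> equals
    \<open>K\<^sub>C + M * m\<close>, the total cost of one recursion step.\<close>
  define K where "K = 2 * (K\<^sub>C + M * m)"
  have nonneg: "0 \<le> M" "0 \<le> m" "0 \<le> K"
    using K\<^sub>C by (auto simp: M_def K_def m_def)
  have bounded_O: "bounded (?O i)" if "i < N" for i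
    using bounded_subset[OF orbital_set_bounded] that by blast
  have M: "real (covering_number \<delta> (?O i)) \<le> M" if "1 \<le> \<delta>" "i < N" for \<delta> i
    unfolding M_def of_nat_le_iff
    using that orbital_set_bounded by (intro covering_number_mono) auto
  have "real (covering_number \<delta> (?O i)) \<le> M + K * h i * \<delta> powr -t"
    if "i < N" "q ^ n \<le> \<delta>" for n \<delta> i
    using that
  proof (induction n arbitrary: i \<delta>)
    case 0
    then show ?case
      using M[of \<delta> i] nonneg h[of i] by (simp add: add_increasing2)
  next
    case (Suc n)
    show ?case
    proof (cases "1 \<le> \<delta>")
      case True
      then show ?thesis
        using M[of \<delta> i] Suc nonneg h[of i] by (simp add: add_increasing2)
    next
      case False
      have \<delta>: "0 < \<delta>" "\<delta> < 1"
        using False Suc.prems(2) q by (auto intro: less_le_trans[of 0 "q ^ Suc n"] simp del: power_Suc)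
      have ge1: "1 \<le> \<delta> powr -t"
        using \<delta> \<open>0 \<le> t\<close> by (simp add: powr_minus one_le_inverse powr_le1)
      have edge: "real (covering_number \<delta> (f e ` ?O (head G e)))
          \<le> M + K * h (head G e) * (\<rho> e powr t * \<delta> powr -t)" if e: "e \<in> arcs G" for e
      \<comment> \<open>The quotient \<open>\<delta> / \<rho> e\<close> is no usable scale for ratio
        0. There the image can be compared with scale 1 instead, and \<open>M\<close> alone suffices
        because \<open>\<rho> e powr t = 0\<close>.\<close>
      proof (cases "\<rho> e = 0")
        case True
        have "covering_number \<delta> (f e ` ?O (head G e)) \<le> covering_number 1 (?O (head G e))"
          using True \<delta> contraction[OF e] bounded_O[OF head_less_N[OF e]]
          by (intro covering_number_lipschitz_image) auto
        also have "real \<dots> \<le> M"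
          using M head_less_N[OF e] by simp
        finally show ?thesis
          using True by simp
      next
        case False
        then have \<rho>: "0 < \<rho> e" "\<rho> e \<le> q"
          using ratio_nonneg[OF e] q(3)[OF e] by auto
        have "q ^ n * \<rho> e \<le> q ^ n * q"
          using \<rho> q by (intro mult_left_mono) auto
        also have "\<dots> \<le> \<delta>"
          using Suc.prems by (simp add: mult.commute)
        finally have le: "q ^ n \<le> \<delta> / \<rho> e"
          using \<rho> by (simp add: field_simps)
        have "covering_number \<delta> (f e ` ?O (head G e)) \<le> covering_number (\<delta> / \<rho> e) (?O (head G e))"
          using \<rho> \<delta> contraction[OF e] bounded_O[OF head_less_N[OF e]]
          by (intro covering_number_lipschitz_image) auto
        also have "real \<dots> \<le> M + K * h (head G e) * (\<delta> / \<rho> e) powr -t"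
          by (rule Suc.IH[OF head_less_N[OF e] le])
        also have "(\<delta> / \<rho> e) powr -t = \<rho> e powr t * \<delta> powr -t"
          using \<rho> \<delta> by (simp add: powr_divide powr_minus field_simps)
        finally show ?thesis by simp
      qed
      have bounded_fO: "bounded (f e ` ?O (head G e))" if "e \<in> arcs G" for e
        using bounded_O[OF head_less_N[OF that]] contraction[OF that]
        by (meson bounded_uniformly_continuous_image lipschitz_on_subset
            lipschitz_on_uniformly_continuous subset_UNIV)
      have bounded_C: "bounded (C i)"
        using C_compact verts_eq Suc.prems compact_imp_bounded by auto
      let ?U = "\<Union>e\<in>out_arcs G i. f e ` ?O (head G e)"
      have bounded_U: "bounded ?U"
        using bounded_fO by (intro bounded_UN) auto
      have "covering_number \<delta> (?O i) \<le> covering_number \<delta> (C i \<union> ?U)"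
        using orbital_set_subset bounded_C bounded_U \<delta> by (intro covering_number_mono) auto
      also have "\<dots> \<le> covering_number \<delta> (C i) + covering_number \<delta> ?U"
        using bounded_C bounded_U \<delta> by (intro covering_number_Un)
      also have "\<dots> \<le> covering_number \<delta> (C i)
          + (\<Sum>e\<in>out_arcs G i. covering_number \<delta> (f e ` ?O (head G e)))"
        using bounded_fO \<delta> by (intro add_left_mono covering_number_UN) auto
      finally have "real (covering_number \<delta> (?O i)) \<le> real (covering_number \<delta> (C i))
          + (\<Sum>e\<in>out_arcs G i. real (covering_number \<delta> (f e ` ?O (head G e))))"
        by (simp flip: of_nat_sum of_nat_add)
      also have "\<dots> \<le> K\<^sub>C * \<delta> powr -t
          + (\<Sum>e\<in>out_arcs G i. M + K * h (head G e) * (\<rho> e powr t * \<delta> powr -t))"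
        using K\<^sub>C(2)[of i \<delta>] Suc.prems \<delta> edge by (intro add_mono sum_mono) auto
      also have "\<dots> = K\<^sub>C * \<delta> powr -t + M * real (card (out_arcs G i))
          + K * (\<Sum>e\<in>out_arcs G i. \<rho> e powr t * h (head G e)) * \<delta> powr -t"
        by (simp add: sum.distrib sum_distrib_left sum_distrib_right mult_ac)
      \<comment> \<open>As \<open>\<delta> < 1\<close>, the additive constants are absorbed into
        \<open>\<delta> powr -t\<close>; \<open>super\<close> then supplies the compensating
        \<open>- 1/2\<close>.\<close>
      also have "\<dots> \<le> K\<^sub>C * \<delta> powr -t + M * m * \<delta> powr -t + K * (h i - 1/2) * \<delta> powr -t"
      proof (intro add_mono mult_right_mono mult_left_mono super order_refl)
        have "real (card (out_arcs G i)) \<le> m"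
          unfolding m_def by (auto intro!: card_mono simp: out_arcs_def)
        then have "M * real (card (out_arcs G i)) \<le> M * m * 1"
          using nonneg by (simp add: mult_left_mono)
        also have "\<dots> \<le> M * m * \<delta> powr -t"
          using nonneg ge1 by (intro mult_left_mono) auto
        finally show "M * real (card (out_arcs G i)) \<le> M * m * \<delta> powr -t" .
      qed (use nonneg Suc.prems in auto)
      also have "\<dots> = K * h i * \<delta> powr -t"
        by (simp add: K_def algebra_simps)
      finally show ?thesis
        using nonneg by linarith
    qed
  qed
  \<comment> \<open>Since \<open>q < 1\<close>, the induction reaches every positive scale.\<close>
  moreover have "\<exists>n. q ^ n \<le> \<delta>" if "0 < \<delta>" for \<delta>
    using real_arch_pow_inv[OF that q(2)] less_imp_le by blast
  ultimately show thesis
    using that nonneg by blast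
qed

section \<open>From the counting estimate to the dimension bound\<close>

lemma mw_radius_less_1:
  assumes "mw_dimension G N \<rho> < s"
  shows "0 < mw_dimension G N \<rho>" "mw_radius G N \<rho> s < 1"
proof -
  have "0 < mw_dimension G N \<rho> \<and> mw_radius G N \<rho> (mw_dimension G N \<rho>) = 1"
    unfolding mw_dimension_def by (rule theI'[OF mw_dimension_exists])
  then show "0 < mw_dimension G N \<rho>" "mw_radius G N \<rho> s < 1"
    using monotone_onD[OF radius_decreasing, of "mw_dimension G N \<rho>" s] assms by auto
qed

lemma upper_box_dim_orbital_set_le:
  assumes mw: "mw_dimension G N \<rho> < t" and dim: "\<And>i. i < N \<Longrightarrow> upper_box_dim (C i) < ereal t"
    and "i < N"
  shows "upper_box_dim (orbital_set G f C i) \<le> ereal t"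
proof -
  have t: "0 \<le> t"
    using mw_radius_less_1(1)[OF mw] mw by linarith
  \<comment> \<open>The intermediate exponent has spectral radius below 1 and leaves the gap
    \<open>t - s\<close> that the supersolution needs.\<close>
  obtain s where s: "mw_dimension G N \<rho> < s" "s < t"
    using dense[OF mw] by blast
  obtain h :: "nat \<Rightarrow> real" where h: "\<And>i. 0 \<le> h i"
    "\<And>i. i < N \<Longrightarrow> (\<Sum>e\<in>out_arcs G i. \<rho> e powr t * h (head G e)) \<le> h i - 1/2"
    using supersolution[OF mw_radius_less_1(2)[OF s(1)] s(2)] by blast
  have "\<exists>k. 0 \<le> k \<and> (\<forall>\<delta>. 0 < \<delta> \<longrightarrow> \<delta> \<le> 1 \<longrightarrow> real (covering_number \<delta> (C i)) \<le> k * \<delta> powr -t)"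
    if "i < N" for i
    using covering_number_powr_bound_if_dim_less[of "C i" t] dim[OF that] t C_compact[of i] that
      compact_imp_bounded verts_eq by (metis lessThan_iff)
  then obtain k where k: "0 \<le> k i"
      "0 < \<delta> \<Longrightarrow> \<delta> \<le> 1 \<Longrightarrow> real (covering_number \<delta> (C i)) \<le> k i * \<delta> powr -t" if "i < N" for i \<delta>
    by metis
  \<comment> \<open>Summing the nonnegative vertex constants gives one constant valid at every
    vertex.\<close>
  define K\<^sub>C where "K\<^sub>C = sum k {..<N}"
  have K\<^sub>C_nonneg: "0 \<le> K\<^sub>C"
    using k by (auto simp: K\<^sub>C_def intro: sum_nonneg)
  have K\<^sub>C: "real (covering_number \<delta> (C i)) \<le> K\<^sub>C * \<delta> powr -t"
    if "i < N" "0 < \<delta>" "\<delta> \<le> 1" for i \<delta>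
  proof -
    have "k i \<le> K\<^sub>C"
      unfolding K\<^sub>C_def using k that by (intro member_le_sum) auto
    then show ?thesis
      using k(2)[of i \<delta>] that by (meson mult_right_mono order_trans powr_ge_zero)
  qed
  obtain M K where KM: "0 \<le> M" "\<forall>i<N. \<forall>\<delta>>0.
      real (covering_number \<delta> (orbital_set G f C i)) \<le> M + K * h i * \<delta> powr -t"
    by (rule covering_number_orbital_set_le[OF t h K\<^sub>C_nonneg K\<^sub>C]) assumption+
  show ?thesis
  proof (rule upper_box_dim_le_if_covering_number_powr_bound[OF _ t])
    fix \<delta> :: real assume \<delta>: "0 < \<delta>" "\<delta> \<le> 1"
    have "1 \<le> \<delta> powr -t"
      using \<delta> t by (simp add: powr_minus one_le_inverse powr_le1)
    then have "M \<le> M * \<delta> powr -t"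
      using KM(1) by (simp add: mult_le_cancel_left1)
    then show "real (covering_number \<delta> (orbital_set G f C i)) \<le> (M + K * h i) * \<delta> powr -t"
      using KM(2)[rule_format, OF \<open>i < N\<close> \<delta>(1)] by (simp add: algebra_simps)
  qed
qed

end

theorem theorem4p13:
  fixes G :: "(nat, 'e) pre_digraph"
    and N :: nat
    and f :: "'e \<Rightarrow> real ^ 'n \<Rightarrow> real ^ 'n"
    and \<rho> :: "'e \<Rightarrow> real"
    and C :: "nat \<Rightarrow> (real ^ 'n) set"
  assumes "gdifs G N f \<rho> C"
    and "\<And>i j. i < N \<Longrightarrow> j < N \<Longrightarrow> upper_box_dim (C i) = upper_box_dim (C j)"
  shows "\<forall>i<N. upper_box_dim (orbital_set G f C i)
           \<le> max (ereal (mw_dimension G N \<rho>)) (upper_box_dim (C i))"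
proof (intro allI impI)
  interpret gdifs G N f \<rho> C
    by fact
  fix i assume i: "i < N"
  show "upper_box_dim (orbital_set G f C i)
      \<le> max (ereal (mw_dimension G N \<rho>)) (upper_box_dim (C i))" (is "_ \<le> ?m")
  \<comment> \<open>The previous bound concerns a real exponent strictly above both quantities, so
    the maximum is approached from above by such \<open>t\<close>.\<close>
  proof (rule dense_ge)
    fix y assume "?m < y"
    then obtain t where t: "?m < ereal t" "ereal t < y"
      using ereal_dense2 by blast
    have "upper_box_dim (orbital_set G f C i) \<le> ereal t"
    proof (rule upper_box_dim_orbital_set_le[OF _ _ i])
      show "mw_dimension G N \<rho> < t"
        using t by simp
      \<comment> \<open>Equality of the dimensions carries the bound from \<open>C i\<close> to the
        condensation sets at all vertices, which paths from \<open>i\<close> may reach.\<close>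
      show "upper_box_dim (C j) < ereal t" if "j < N" for j
        using t assms(2)[OF that i] by simp
    qed
    then show "upper_box_dim (orbital_set G f C i) \<le> y"
      using t by simp
  qed
qed

end
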